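(* Let $n>2$, let $m_1>m_2>\cdots>m_n>0$ and $1+r>0$ be real numbers with $m_1>1+r>m_n$, and let $\mathcal{Q}$ be the set of equivalent martingale measures of the one-period $n$-nomial market model with parameters $m_1,\ldots,m_n$ and $1+r$, with risky asset prices $S_0$ and $S_1$ at times $0$ and $1$. Let $\mathcal{F}$ be the power set of $\Omega=\{1,\ldots,n\}$, let $\underline{Q}(A)=\min_{Q\in\mathrm{cl}(\mathcal{Q})}Q(A)$ for $A\in\mathcal{F}$, and let $\mathbf{B}(\Omega,\mathcal{F})$ be the set of all belief functions on $\mathcal{F}$. For a distance $d$ on $\mathbf{B}(\Omega,\mathcal{F})$ consider the optimization problem: minimize $d(\widehat{Bel},\underline{Q})$ subject to $$\begin{cases}\widehat{Bel}(A)\ge\underline{Q}(A)\ \text{ for every }A\in\mathcal{F},\\ (1+r)^{-1}\mathbb{C}_{\widehat{Bel}}(S_1)=S_0,\\ (1+r)^{-1}\mathbb{C}_{\widehat{Bel}}(-S_1)=-S_0,\\ \widehat{Bel}\in\mathbf{B}(\Omega,\mathcal{F}),\end{cases}$$ where $\mathbb{C}_{\widehat{Bel}}$ denotes Choquet expectation with respect to $\widehat{Bel}$. For every distance $d$ defined on $\mathbf{B}(\Omega,\mathcal{F})$, the set of feasible solutions of this problem is $\mathrm{cl}(\mathcal{Q})$. Further, if $d=d_1$ then the set of optimal solutions of the problem coincides with $\mathrm{cl}(\mathcal{Q})$, while if $d=d_2$ then there is a unique optimal solution, where $$d_1(Bel_1,Bel_2)=\sum_{A\in\mathcal{F}}|Bel_1(A)-Bel_2(A)|,\qquad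 d_2(Bel_1,Bel_2)=\sum_{A\in\mathcal{F}}(Bel_1(A)-Bel_2(A))^2.$$
   Context: One-period $n$-nomial market model: $\Omega=\{1,\ldots,n\}$, $\mathcal{F}$ is the power set of $\Omega$, and $P$ is a probability measure on $\mathcal{F}$ with $P(\{i\})>0$ for all $i\in\Omega$. There is a risk-free asset with $B_0=1$, $B_1=1+r>0$, and a risky asset with price $S_0>0$ at time $0$ and price $S_1(i)=m_iS_0$, $i\in\Omega$, at time $1$, where $m_1>\cdots>m_n>0$. The set of equivalent martingale measures is $$\mathcal{Q}=\{Q \text{ probability measure on }\mathcal{F}\,:\,(1+r)^{-1}\mathbb{E}_Q(S_1)=S_0,\ Q\sim P\},$$ where $Q\sim P$ means that $Q$ and $P$ have the same null sets (i.e. $Q(\{i\})>0$ for all $i$). Identifying a probability measure with the vector $(Q(\{1\}),\ldots,Q(\{n\}))^T$, $\mathrm{cl}(\mathcal{Q})$ denotes the closure of $\mathcal{Q}$ in $\mathbb{R}^n$. In this setting $\underline{Q}$ is itself a belief function, so $d(\widehat{Bel},\underline{Q})$ is meaningful. A (normalized) capacity on $\mathcal{F}$ is a function $\varphi:\mathcal{F}\to[0,1]$ with $\varphi(\emptyset)=0$, $\varphi(\Omega)=1$ and $\varphi(A)\le\varphi(B)$ whenever $A\subseteq B$. A belief function is a capacity $\varphi$ that is completely monotone: for every $k\ge2$ and $A_1,\ldots,A_k\in\mathcal{F}$, $$\varphi\left(\bigcup_{i=1}^kA_i\right)\ge\sum_{\emptyset\neq K\subseteq\{1,\ldots,k\}}(-1)^{|K|-1}\varphi\left(\bigcap_{i\in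 K}A_i\right).$$ Probability measures are particular belief functions. The Choquet expectation of $X\in\mathbb{R}^\Omega$ with respect to a capacity $\varphi$ is $$\mathbb{C}_\varphi(X)=\sum_{i=1}^n\bigl(X(\sigma(i))-X(\sigma(i+1))\bigr)\varphi(\{\sigma(1),\ldots,\sigma(i)\}),$$ where $\sigma$ is a permutation of $\Omega$ with $X(\sigma(1))\ge\cdots\ge X(\sigma(n))$ and $X(\sigma(n+1)):=0$. Following the paper's terminology, $d_2$ (a sum of squares without square root) is also called a distance. *)

theory Defs
  imports "HOL-Probability.Probability"
begin

(* Set functions on the power set of W are total functions that are undefined outside Pow W
   (PiE), so that equality of set functions is equality on Pow W. *)
definition capacity :: "'a set \<Rightarrow> ('a set \<Rightarrow> real) \<Rightarrow> bool" where
  "capacity W \<phi> \<longleftrightarrow> \<phi> \<in> Pow W \<rightarrow>\<^sub>E {0..1} \<and> \<phi> {} = 0 \<and> \<phi> W = 1 \<and>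
     (\<forall>A B. A \<subseteq> B \<and> B \<subseteq> W \<longrightarrow> \<phi> A \<le> \<phi> B)"

definition belief_functions :: "'a set \<Rightarrow> ('a set \<Rightarrow> real) set" where
  "belief_functions W = {\<phi>. capacity W \<phi> \<and>
     (\<forall>k\<ge>2. \<forall>A :: nat \<Rightarrow> 'a set. (\<forall>i\<in>{1..k}. A i \<subseteq> W) \<longrightarrow>
        \<phi> (\<Union>i\<in>{1..k}. A i) \<ge>
          (\<Sum>K | K \<noteq> {} \<and> K \<subseteq> {1..k}. (-1) ^ (card K - 1) * \<phi> (\<Inter>i\<in>K. A i)))}"

(* The value does not depend on which of the sorting permutations is chosen. *)
definition choquet :: "nat \<Rightarrow> (nat set \<Rightarrow> real) \<Rightarrow> (nat \<Rightarrow> real) \<Rightarrow> real" where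
  "choquet n \<phi> X =
     (let \<sigma> = (SOME \<sigma>. \<sigma> permutes {1..n} \<and> antimono_on {1..n} (\<lambda>i. X (\<sigma> i)))
      in \<Sum>i = 1..n. (X (\<sigma> i) - (if i = n then 0 else X (\<sigma> (i + 1)))) * \<phi> (\<sigma> ` {1..i}))"

definition price1 :: "(nat \<Rightarrow> real) \<Rightarrow> real \<Rightarrow> nat \<Rightarrow> real" where
  "price1 m S0 i = m i * S0"

definition emm :: "nat \<Rightarrow> nat measure \<Rightarrow> (nat \<Rightarrow> real) \<Rightarrow> real \<Rightarrow> real \<Rightarrow> nat measure set" where
  "emm n P m r S0 = {Q. prob_space Q \<and> sets Q = Pow {1..n} \<and>
     inverse (1 + r) * (\<integral>i. price1 m S0 i \<partial>Q) = S0 \<and> null_sets Q = null_sets P}"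

definition prob_vector :: "nat \<Rightarrow> nat measure \<Rightarrow> nat \<Rightarrow> real" where
  "prob_vector n Q = (\<lambda>i\<in>{1..n}. measure Q {i})"

definition set_function_of :: "nat \<Rightarrow> (nat \<Rightarrow> real) \<Rightarrow> nat set \<Rightarrow> real" where
  "set_function_of n v = (\<lambda>A\<in>Pow {1..n}. \<Sum>i\<in>A. v i)"

(* The closure is taken in R^n, the space of extensional functions on {1..n} with the product
   topology; the limit vectors are then read as additive set functions on Pow {1..n}. *)
definition cl_emm :: "nat \<Rightarrow> nat measure \<Rightarrow> (nat \<Rightarrow> real) \<Rightarrow> real \<Rightarrow> real \<Rightarrow> (nat set \<Rightarrow> real) set" where
  "cl_emm n P m r S0 =
     set_function_of n ` (powertop_real {1..n} closure_of (prob_vector n ` emm n P m r S0))"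

(* LEAST denotes the minimum of the (infinite) set of values. *)
definition lower_prob :: "nat \<Rightarrow> nat measure \<Rightarrow> (nat \<Rightarrow> real) \<Rightarrow> real \<Rightarrow> real \<Rightarrow> nat set \<Rightarrow> real" where
  "lower_prob n P m r S0 =
     (\<lambda>A\<in>Pow {1..n}. LEAST x. x \<in> (\<lambda>Q. Q A) ` cl_emm n P m r S0)"

record 'a minimization_problem =
  feasible_solutions :: "'a set"
  objective :: "'a \<Rightarrow> real"

definition optimal_solutions :: "'a minimization_problem \<Rightarrow> 'a set" where
  "optimal_solutions p = {x. is_arg_min (objective p) (\<lambda>y. y \<in> feasible_solutions p) x}"

definition belief_problem ::
  "nat \<Rightarrow> nat measure \<Rightarrow> (nat \<Rightarrow> real) \<Rightarrow> real \<Rightarrow> real \<Rightarrow>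
   ((nat set \<Rightarrow> real) \<Rightarrow> (nat set \<Rightarrow> real) \<Rightarrow> real) \<Rightarrow> (nat set \<Rightarrow> real) minimization_problem" where
  "belief_problem n P m r S0 d =
     \<lparr>feasible_solutions = {Bel.
        (\<forall>A\<in>Pow {1..n}. Bel A \<ge> lower_prob n P m r S0 A) \<and>
        inverse (1 + r) * choquet n Bel (price1 m S0) = S0 \<and>
        inverse (1 + r) * choquet n Bel (\<lambda>i. - price1 m S0 i) = - S0 \<and>
        Bel \<in> belief_functions {1..n}},
      objective = (\<lambda>Bel. d Bel (lower_prob n P m r S0))\<rparr>"

definition dist1 :: "'a set \<Rightarrow> ('a set \<Rightarrow> real) \<Rightarrow> ('a set \<Rightarrow> real) \<Rightarrow> real" where
  "dist1 W f g = (\<Sum>A\<in>Pow W. \<bar>f A - g A\<bar>)"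

definition dist2 :: "'a set \<Rightarrow> ('a set \<Rightarrow> real) \<Rightarrow> ('a set \<Rightarrow> real) \<Rightarrow> real" where
  "dist2 W f g = (\<Sum>A\<in>Pow W. (f A - g A)\<^sup>2)"

end

(*
The two Choquet constraints add up to
  sum_i (m_i - m_(i+1)) * (Bel {1..i} + Bel {i+1..n} - 1) = 0.
Superadditivity makes every summand nonpositive, hence Bel {1..i} + Bel {i+1..n} = 1 for all i, and
2-monotonicity then forces Bel to be additive. So the feasible set consists of the probability
vectors with mean 1 + r, which is cl(Q): any such vector is a limit of its convex combinations with
a strictly positive one. This set is compact and convex. Each probability measure has the same sum
over all events, so d_1 is constant on it, whereas d_2 is strictly convex.
*)
theory Submission
  imports Defs
begin

section \<open>Martingale probability vectors: convexity, positive elements, compactness and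
  closure\<close>

definition mart_vectors :: "nat \<Rightarrow> (nat \<Rightarrow> real) \<Rightarrow> real \<Rightarrow> (nat \<Rightarrow> real) set" where
  "mart_vectors n m c = {v \<in> extensional {1..n}.
     (\<forall>i\<in>{1..n}. 0 \<le> v i) \<and> (\<Sum>i=1..n. v i) = 1 \<and> (\<Sum>i=1..n. m i * v i) = c}"

text \<open>With c = 1 + r these are the vectors of the equivalent martingale measures, see
  \<open>prob_vector_image_emm\<close>. Membership in \<open>extensional {1..n}\<close> makes the
  vectors points of \<open>powertop_real {1..n}\<close>, where the closure is taken.\<close>

definition pos_mart_vectors :: "nat \<Rightarrow> (nat \<Rightarrow> real) \<Rightarrow> real \<Rightarrow> (nat \<Rightarrow> real) set" where
  "pos_mart_vectors n m c = {v \<in> mart_vectors n m c. \<forall>i\<in>{1..n}. 0 < v i}"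

lemma mart_vectors_convex:
  assumes "v \<in> mart_vectors n m c" "w \<in> mart_vectors n m c" "0 \<le> t" "t \<le> 1"
  shows "(\<lambda>i\<in>{1..n}. (1 - t) * v i + t * w i) \<in> mart_vectors n m c"
proof -
  have 1: "(\<Sum>i=1..n. (1 - t) * v i + t * w i) = (1 - t) * (\<Sum>i=1..n. v i) + t * (\<Sum>i=1..n. w i)"
    by (simp add: sum.distrib sum_distrib_left)
  have 2: "(\<Sum>i=1..n. m i * ((1 - t) * v i + t * w i))
      = (1 - t) * (\<Sum>i=1..n. m i * v i) + t * (\<Sum>i=1..n. m i * w i)"
    by (simp add: sum.distrib sum_distrib_left distrib_left mult.left_commute)
  show ?thesis
    using assms 1 2 by (auto simp: mart_vectors_def simp flip: distrib_right)
qed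

lemma pos_mart_vectors_mix:
  assumes "v \<in> mart_vectors n m c" "w \<in> pos_mart_vectors n m c" "0 < t" "t \<le> 1"
  shows "(\<lambda>i\<in>{1..n}. (1 - t) * v i + t * w i) \<in> pos_mart_vectors n m c"
proof -
  have "0 < (1 - t) * v i + t * w i" if "i \<in> {1..n}" for i
    using assms that by (auto simp: mart_vectors_def pos_mart_vectors_def intro!: add_nonneg_pos)
  then show ?thesis
    using mart_vectors_convex[of v n m c w t] assms by (auto simp: pos_mart_vectors_def)
qed

text \<open>The witness mixes the uniform distribution, with weight 1 - t, and the point mass at k,
  with weight t. As t < 1, the uniform part keeps every coordinate positive.\<close>

lemma pos_mart_vectors_tilt:
  assumes "k \<in> {1..n}" "0 \<le> t" "t < 1"
    and "(1 - t) * ((\<Sum>i=1..n. m i) / n) + t * m k = c"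
  shows "pos_mart_vectors n m c \<noteq> {}"
proof -
  let ?d = "\<lambda>i. if i = k then t else 0"
  let ?v = "\<lambda>i\<in>{1..n}. (1 - t) / n + ?d i"
  have n: "n > 0" using assms by auto
  have "(\<Sum>i=1..n. ?v i) = (\<Sum>i=1..n. (1 - t) / n) + (\<Sum>i=1..n. ?d i)"
    by (simp add: sum.distrib)
  also have "\<dots> = 1"
    using assms n by simp
  finally have 1: "(\<Sum>i=1..n. ?v i) = 1" .
  have "(\<Sum>i=1..n. m i * ?v i) = (\<Sum>i=1..n. m i * ((1 - t) / n)) + (\<Sum>i=1..n. m i * ?d i)"
    by (simp add: sum.distrib distrib_left)
  also have "(\<Sum>i=1..n. m i * ?d i) = t * m k"
    using assms by (simp add: if_distrib cong: if_cong)
  also have "(\<Sum>i=1..n. m i * ((1 - t) / n)) = (1 - t) * ((\<Sum>i=1..n. m i) / n)"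
    by (simp add: sum_distrib_right[symmetric] sum_divide_distrib[symmetric])
  finally have 2: "(\<Sum>i=1..n. m i * ?v i) = c" using assms by simp
  have 3: "0 < ?v i" if "i \<in> {1..n}" for i
    using assms that n by (auto intro!: add_pos_nonneg)
  have "?v \<in> pos_mart_vectors n m c"
    unfolding pos_mart_vectors_def mart_vectors_def using 1 2 3
    by (auto simp del: restrict_apply intro: less_imp_le)
  then show ?thesis by blast
qed

text \<open>The uniform distribution has mean u. If u is at most c, tilting it towards b raises the
  mean to c; otherwise tilting it towards a lowers the mean to c.\<close>

lemma pos_mart_vectors_nonempty:
  assumes "a \<in> {1..n}" "b \<in> {1..n}" "m a < c" "c < m b"
  shows "pos_mart_vectors n m c \<noteq> {}"
proof -
  define u where "u = (\<Sum>i=1..n. m i) / n"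
  show ?thesis
  proof (cases "u \<le> c")
    case True
    \<comment> \<open>This t solves the linear equation for the mean; u <= c < m b places it in [0,
      1).\<close>
    have "(1 - t) * u + t * m b = c" if "t = (c - u) / (m b - u)" for t
    proof -
      have "t * (m b - u) = c - u" using that True assms by simp
      then show ?thesis by (simp add: algebra_simps)
    qed
    then show ?thesis
      using assms True
      by (intro pos_mart_vectors_tilt[where n = n and m = m and k = b and t = "(c - u) / (m b - u)", folded u_def]) auto
  next
    case False
    have "(1 - t) * u + t * m a = c" if "t = (u - c) / (u - m a)" for t
    proof -
      have "t * (u - m a) = u - c" using that False assms by simp
      then show ?thesis by (simp add: algebra_simps)
    qed
    then show ?thesis
      using assms False
      by (intro pos_mart_vectors_tilt[where n = n and m = m and k = a and t = "(u - c) / (u - m a)", folded u_def]) auto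
  qed
qed

text \<open>Nonnegative coordinates with sum 1 lie in [0, 1], so the set is the intersection of a
  compact cube with two closed sets, the level sets of continuous linear functions.\<close>

lemma compactin_mart_vectors: "compactin (powertop_real {1..n}) (mart_vectors n m c)"
proof -
  let ?T = "powertop_real {1..n}"
  let ?A = "{v \<in> topspace ?T. (\<Sum>i=1..n. v i) \<in> {1}}"
  let ?B = "{v \<in> topspace ?T. (\<Sum>i=1..n. m i * v i) \<in> {c}}"
  have le: "v i \<le> 1" if "v \<in> mart_vectors n m c" "i \<in> {1..n}" for v i
  proof -
    have "v i \<le> (\<Sum>i=1..n. v i)"
      using that by (intro member_le_sum) (simp_all add: mart_vectors_def)
    then show ?thesis using that by (simp add: mart_vectors_def)
  qed
  have top: "v \<in> topspace ?T \<longleftrightarrow> v \<in> extensional {1..n}" for v :: "nat \<Rightarrow> real"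
    by (simp add: PiE_iff)
  have "v \<in> mart_vectors n m c \<longleftrightarrow> v \<in> PiE {1..n} (\<lambda>_. {0..1}) \<inter> (?A \<inter> ?B)" for v
    unfolding Int_iff mem_Collect_eq top PiE_iff singleton_iff atLeastAtMost_iff
    using le[of v] by (auto simp only: mart_vectors_def mem_Collect_eq atLeastAtMost_iff)
  then have eq: "mart_vectors n m c = PiE {1..n} (\<lambda>_. {0..1}) \<inter> (?A \<inter> ?B)"
    by (rule set_eqI)
  have "closedin ?T ?A" "closedin ?T ?B"
    by (rule closedin_continuous_map_preimage[where Y = euclideanreal];
        auto intro!: continuous_intros continuous_map_product_projection)+
  then show ?thesis
    unfolding eq by (intro compact_Int_closedin closedin_Int) (auto simp: compactin_PiE)
qed

lemma closure_of_pos_mart_vectors: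
  assumes "pos_mart_vectors n m c \<noteq> {}"
  shows "powertop_real {1..n} closure_of (pos_mart_vectors n m c) = mart_vectors n m c"
proof
  let ?T = "powertop_real {1..n}"
  have "closedin ?T (mart_vectors n m c)"
    by (intro compactin_imp_closedin compactin_mart_vectors)
      (simp add: Hausdorff_space_product_topology)
  then show "?T closure_of (pos_mart_vectors n m c) \<subseteq> mart_vectors n m c"
    by (intro closure_of_minimal) (auto simp: pos_mart_vectors_def)
  obtain w where w: "w \<in> pos_mart_vectors n m c" using assms by blast
  show "mart_vectors n m c \<subseteq> ?T closure_of (pos_mart_vectors n m c)"
  proof
    fix v assume v: "v \<in> mart_vectors n m c"
    let ?g = "\<lambda>t. \<lambda>i\<in>{1..n}. (1 - t) * v i + t * w i"
    \<comment> \<open>The segment from v to w is a continuous curve whose points with 0 < t < 1 are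
      strictly positive. Since 0 is in the closure of the open interval, the endpoint v is in the
      closure of the positive vectors.\<close>
    have "continuous_map euclideanreal ?T ?g"
      unfolding continuous_map_componentwise by (auto intro!: continuous_intros)
    then have "?g ` (euclideanreal closure_of {0<..<1}) \<subseteq> ?T closure_of (?g ` {0<..<1})"
      by (rule continuous_map_image_closure_subset)
    also have "\<dots> \<subseteq> ?T closure_of (pos_mart_vectors n m c)"
      using pos_mart_vectors_mix[OF v w] by (intro closure_of_mono) auto
    finally have "?g ` {0..1} \<subseteq> ?T closure_of (pos_mart_vectors n m c)"
      by simp
    then have "?g 0 \<in> ?T closure_of (pos_mart_vectors n m c)"
      by (rule subsetD) (rule imageI, simp)
    moreover have "?g 0 = v"
      using v by (auto simp: mart_vectors_def extensional_def)
    ultimately show "v \<in> ?T closure_of (pos_mart_vectors n m c)" by simp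
  qed
qed

section \<open>From measures on a finite space to vectors\<close>

lemma integral_finite_sets:
  fixes f :: "'a \<Rightarrow> real"
  assumes "prob_space Q" "sets Q = Pow W" "finite W"
  shows "(\<integral>i. f i \<partial>Q) = (\<Sum>i\<in>W. f i * measure Q {i})"
proof -
  interpret prob_space Q by fact
  have sp: "space Q = W" using sets_eq_imp_space_eq[of Q "count_space W"] assms by simp
  \<comment> \<open>On a finite space every function is a finite combination of indicators of
    points.\<close>
  have "(\<integral>i. f i \<partial>Q) = (\<integral>i. (\<Sum>j\<in>W. f j * indicator {j} i) \<partial>Q)"
    using sp assms by (intro Bochner_Integration.integral_cong) (auto simp: indicator_def)
  also have "\<dots> = (\<Sum>j\<in>W. \<integral>i. f j * indicator {j} i \<partial>Q)"
    using assms by (intro Bochner_Integration.integral_sum) (auto intro!: integrable_real_mult_indicator simp: emeasure_eq_measure)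
  also have "\<dots> = (\<Sum>i\<in>W. f i * measure Q {i})"
    using assms sp by (intro sum.cong) auto
  finally show ?thesis .
qed

text \<open>Applied to P it shows that only the empty set is null; applied to Q it then turns
  equivalence with P into positivity at every point.\<close>

lemma null_sets_trivial_iff:
  assumes "prob_space Q" "sets Q = Pow W"
  shows "null_sets Q = {{}} \<longleftrightarrow> (\<forall>i\<in>W. 0 < measure Q {i})"
proof -
  interpret prob_space Q by fact
  have *: "A \<in> null_sets Q \<longleftrightarrow> A \<subseteq> W \<and> measure Q A = 0" for A
    using assms by (auto simp: null_sets_def emeasure_eq_measure)
  show ?thesis
  proof
    assume "null_sets Q = {{}}"
    then show "\<forall>i\<in>W. 0 < measure Q {i}"
      using *[of "{i}" for i] by (auto simp: zero_less_measure_iff)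
  next
    assume pos: "\<forall>i\<in>W. 0 < measure Q {i}"
    have "A = {}" if "A \<subseteq> W" "measure Q A = 0" for A
    proof (rule ccontr)
      assume "A \<noteq> {}"
      then obtain i where "i \<in> A" by blast
      then have "measure Q {i} \<le> measure Q A"
        using that assms by (intro finite_measure_mono) auto
      then show False using pos that \<open>i \<in> A\<close> by force
    qed
    then show "null_sets Q = {{}}" using * by auto
  qed
qed

text \<open>Removes the price scale \<open>S0\<close> from the pricing constraints; it is used with
  y = 1 and y = -1.\<close>

lemma discounted_eq_iff:
  fixes b s x y :: real
  assumes "b > 0" "s > 0"
  shows "inverse b * (s * x) = s * y \<longleftrightarrow> x = b * y"
proof -
  have "inverse b * (s * x) = s * (x / b)" by (simp add: divide_inverse mult_ac)
  then show ?thesis using assms by (simp add: divide_eq_eq mult.commute)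
qed

lemma prob_vector_image_emm:
  assumes "prob_space P" "sets P = Pow {1..n}" "\<And>i. i \<in> {1..n} \<Longrightarrow> measure P {i} > 0"
    and "1 + r > 0" "S0 > 0"
  shows "prob_vector n ` emm n P m r S0 = pos_mart_vectors n m (1 + r)"
proof -
  have P: "null_sets P = {{}}"
    using assms null_sets_trivial_iff[of P "{1..n}"] by simp
  have price: "inverse (1 + r) * (\<Sum>i=1..n. price1 m S0 i * v i) = S0
      \<longleftrightarrow> (\<Sum>i=1..n. m i * v i) = 1 + r" for v :: "nat \<Rightarrow> real"
  proof -
    have "(\<Sum>i=1..n. price1 m S0 i * v i) = S0 * (\<Sum>i=1..n. m i * v i)"
      by (simp add: price1_def sum_distrib_left algebra_simps)
    then show ?thesis using discounted_eq_iff[OF assms(4,5), of _ 1] by simp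
  qed
  have emm: "Q \<in> emm n P m r S0 \<longleftrightarrow> prob_space Q \<and> sets Q = Pow {1..n} \<and>
      (\<Sum>i=1..n. m i * measure Q {i}) = 1 + r \<and> (\<forall>i\<in>{1..n}. 0 < measure Q {i})" for Q
    unfolding emm_def P
    using price[of "\<lambda>i. measure Q {i}"] integral_finite_sets[of Q "{1..n}" "price1 m S0"]
      null_sets_trivial_iff[of Q "{1..n}"] by auto
  show ?thesis
  proof
    show "prob_vector n ` emm n P m r S0 \<subseteq> pos_mart_vectors n m (1 + r)"
    proof
      fix v assume "v \<in> prob_vector n ` emm n P m r S0"
      then obtain Q where Q: "prob_space Q" "sets Q = Pow {1..n}"
          "(\<Sum>i=1..n. m i * measure Q {i}) = 1 + r" "\<forall>i\<in>{1..n}. 0 < measure Q {i}"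
          and v: "v = prob_vector n Q"
        using emm by auto
      have "(\<Sum>i=1..n. measure Q {i}) = (\<integral>i. 1 \<partial>Q)"
        using integral_finite_sets[of Q "{1..n}" "\<lambda>_. 1"] Q by simp
      also have "\<dots> = 1" using Q(1) by (simp add: prob_space.prob_space)
      finally show "v \<in> pos_mart_vectors n m (1 + r)"
        using Q by (auto simp: v prob_vector_def pos_mart_vectors_def mart_vectors_def)
    qed
    show "pos_mart_vectors n m (1 + r) \<subseteq> prob_vector n ` emm n P m r S0"
    proof
      fix v assume v: "v \<in> pos_mart_vectors n m (1 + r)"
      \<comment> \<open>The preimage of v puts mass \<open>v i\<close> on the point i; a point
        measure has all subsets of \<open>{1..n}\<close> as its measurable sets.\<close>
      define Q where "Q = point_measure {1..n} (\<lambda>i. ennreal (v i))"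
      have nn: "\<And>i. i \<in> {1..n} \<Longrightarrow> 0 < v i" and s1: "(\<Sum>i=1..n. v i) = 1"
        and sm: "(\<Sum>i=1..n. m i * v i) = 1 + r" and ex: "v \<in> extensional {1..n}"
        using v by (auto simp: pos_mart_vectors_def mart_vectors_def)
      have em: "emeasure Q A = ennreal (\<Sum>i\<in>A. v i)" if "A \<subseteq> {1..n}" for A
        using that nn unfolding Q_def
        by (subst emeasure_point_measure_finite) (auto intro!: sum_ennreal less_imp_le)
      have "prob_space Q"
        by (rule prob_spaceI) (use em[of "{1..n}"] s1 in \<open>simp add: Q_def space_point_measure\<close>)
      moreover have "measure Q {i} = v i" if "i \<in> {1..n}" for i
        using em[of "{i}"] nn[of i] that by (simp add: measure_def)
      moreover have "sets Q = Pow {1..n}" by (simp add: Q_def sets_point_measure)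
      ultimately have "Q \<in> emm n P m r S0" "prob_vector n Q = v"
        using emm nn sm ex by (auto simp: prob_vector_def extensional_def)
      then show "v \<in> prob_vector n ` emm n P m r S0" by blast
    qed
  qed
qed

lemma cl_emm_eq:
  assumes "n > 0" "m n < 1 + r" "1 + r < m 1"
    and "prob_space P" "sets P = Pow {1..n}" "\<And>i. i \<in> {1..n} \<Longrightarrow> measure P {i} > 0"
    and "1 + r > 0" "S0 > 0"
  shows "cl_emm n P m r S0 = set_function_of n ` mart_vectors n m (1 + r)"
proof -
  have "pos_mart_vectors n m (1 + r) \<noteq> {}"
    using assms by (intro pos_mart_vectors_nonempty[of n n 1]) auto
  from closure_of_pos_mart_vectors[OF this] show ?thesis
    using assms by (simp only: cl_emm_def prob_vector_image_emm)
qed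

section \<open>Choquet expectations of strictly monotone payoffs\<close>

lemma strict_mono_on_interval_eq_id:
  fixes f :: "nat \<Rightarrow> nat"
  assumes "strict_mono_on {1..n} f" "f ` {1..n} \<subseteq> {1..n}" "i \<in> {1..n}"
  shows "f i = i"
proof -
  have gap: "f j + d \<le> f (j + d)" if "1 \<le> j" "j + d \<le> n" for j d
    using that
  proof (induction d)
    case (Suc d)
    have "f (j + d) < f (j + Suc d)"
      using Suc.prems by (intro strict_mono_onD[OF assms(1)]) auto
    then show ?case using Suc by auto
  qed simp
  have "1 \<in> {1..n}" "n \<in> {1..n}" using assms(3) by auto
  then have "f 1 \<in> {1..n}" "f n \<in> {1..n}" using assms(2) by blast+
  then show ?thesis
    \<comment> \<open>Growth by at least one per step gives i <= f i when starting from f 1 >= 1,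
      and f i <= i when ending at f n <= n.\<close>
    using gap[of 1 "i - 1"] gap[of i "n - i"] assms(3) by auto
qed

text \<open>A payoff without ties has a single sorting permutation, so the choice operator in
  \<open>choquet\<close> can be evaluated.\<close>

lemma sorting_perm_decreasing:
  fixes X :: "nat \<Rightarrow> real"
  assumes dec: "\<And>i j. 1 \<le> i \<Longrightarrow> i < j \<Longrightarrow> j \<le> n \<Longrightarrow> X j < X i"
    and s: "s permutes {1..n}" "antimono_on {1..n} (\<lambda>i. X (s i))" and i: "i \<in> {1..n}"
  shows "s i = i"
proof (rule strict_mono_on_interval_eq_id[OF _ _ i])
  show "s ` {1..n} \<subseteq> {1..n}" using permutes_image[OF s(1)] by simp
  show "strict_mono_on {1..n} s"
  proof (rule strict_mono_onI)
    fix i j assume ij: "i \<in> {1..n}" "j \<in> {1..n}" "i < j"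
    have "X (s j) \<le> X (s i)" using s(2) ij by (auto simp: monotone_on_def)
    moreover have "s i \<in> {1..n}" "s j \<in> {1..n}" "s i \<noteq> s j"
      using ij permutes_in_image[OF s(1)] inj_onD[OF permutes_inj_on[OF s(1)], of i j UNIV] by auto
    ultimately show "s i < s j" using dec[of "s j" "s i"] by force
  qed
qed

lemma sorting_perm_increasing:
  fixes X :: "nat \<Rightarrow> real"
  assumes inc: "\<And>i j. 1 \<le> i \<Longrightarrow> i < j \<Longrightarrow> j \<le> n \<Longrightarrow> X i < X j"
    and s: "s permutes {1..n}" "antimono_on {1..n} (\<lambda>i. X (s i))" and i: "i \<in> {1..n}"
  shows "s i = n + 1 - i"
proof -
  have in_n: "s k \<in> {1..n}" if "k \<in> {1..n}" for k
    using that permutes_in_image[OF s(1)] by auto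
  \<comment> \<open>Reversal turns the decreasing map s into an increasing one. The subtraction of
    naturals is exact because \<open>s i\<close> lies in \<open>{1..n}\<close>.\<close>
  have "n + 1 - s i = i"
  proof (rule strict_mono_on_interval_eq_id[OF _ _ i])
    show "(\<lambda>i. n + 1 - s i) ` {1..n} \<subseteq> {1..n}" using in_n by fastforce
    show "strict_mono_on {1..n} (\<lambda>i. n + 1 - s i)"
    proof (rule strict_mono_onI)
      fix i j assume ij: "i \<in> {1..n}" "j \<in> {1..n}" "i < j"
      have "X (s j) \<le> X (s i)" using s(2) ij by (auto simp: monotone_on_def)
      moreover have "s i \<noteq> s j"
        using ij inj_onD[OF permutes_inj_on[OF s(1)], of i j UNIV] by auto
      ultimately have "s j < s i" using inc[of "s i" "s j"] in_n ij by force
      then show "n + 1 - s i < n + 1 - s j" using in_n[OF ij(1)] by auto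
    qed
  qed
  then show ?thesis using in_n[OF i] by auto
qed

text \<open>The upper level sets are the initial segments. The last summand stands apart: by the
  convention X (n + 1) = 0 it carries \<open>X n\<close> and not a difference.\<close>

lemma choquet_decreasing:
  assumes dec: "\<And>i j. 1 \<le> i \<Longrightarrow> i < j \<Longrightarrow> j \<le> n \<Longrightarrow> X j < X i" and n: "n > 0"
  shows "choquet n \<phi> X = (\<Sum>i=1..<n. (X i - X (i + 1)) * \<phi> {1..i}) + X n * \<phi> {1..n}"
proof -
  define s where "s = (SOME s. s permutes {1..n} \<and> antimono_on {1..n} (\<lambda>i. X (s i)))"
  \<comment> \<open>The choice operator has its specified property only once a sorting permutation
    is exhibited.\<close>
  have "id permutes {1..n} \<and> antimono_on {1..n} (\<lambda>i. X (id i))"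
    using dec by (fastforce simp: monotone_on_def permutes_id le_less)
  then have "s permutes {1..n} \<and> antimono_on {1..n} (\<lambda>i. X (s i))"
    unfolding s_def by (rule someI[of "\<lambda>s. s permutes {1..n} \<and> antimono_on {1..n} (\<lambda>i. X (s i))" id])
  then have s: "s i = i" if "i \<in> {1..n}" for i
    using sorting_perm_decreasing[of n X s i] dec that by blast
  have im: "s ` {1..i} = {1..i}" if "i \<le> n" for i
    using that s by (auto simp: image_def)
  have "choquet n \<phi> X
      = (\<Sum>i=1..n. (X (s i) - (if i = n then 0 else X (s (i + 1)))) * \<phi> (s ` {1..i}))"
    unfolding choquet_def Let_def s_def by (rule refl)
  also have "{1..n} = insert n {1..<n}" using n by auto
  finally show ?thesis using n s im by (auto intro!: sum.cong)
qed

lemma choquet_increasing: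
  assumes inc: "\<And>i j. 1 \<le> i \<Longrightarrow> i < j \<Longrightarrow> j \<le> n \<Longrightarrow> X i < X j" and n: "n > 0"
  shows "choquet n \<phi> X = (\<Sum>i=1..<n. (X (i + 1) - X i) * \<phi> {i+1..n}) + X 1 * \<phi> {1..n}"
proof -
  define s where "s = (SOME s. s permutes {1..n} \<and> antimono_on {1..n} (\<lambda>i. X (s i)))"
  \<comment> \<open>The reversal of \<open>{1..n}\<close> witnesses that an increasing payoff can be
    sorted; outside the interval it must be the identity to count as a permutation.\<close>
  define t where "t = (\<lambda>i. if i \<in> {1..n} then n + 1 - i else i)"
  have "bij_betw t {1..n} {1..n}"
    by (rule bij_betw_byWitness[where f' = t]) (auto simp: t_def)
  then have "t permutes {1..n}" by (rule bij_imp_permutes) (auto simp: t_def)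
  moreover have "X (t j) \<le> X (t i)" if "i \<in> {1..n}" "j \<in> {1..n}" "i \<le> j" for i j
  proof (cases "i = j")
    case False
    then have "1 \<le> t j" "t j < t i" "t i \<le> n" using that by (auto simp: t_def)
    then show ?thesis using inc by (intro less_imp_le)
  qed simp
  ultimately have "t permutes {1..n} \<and> antimono_on {1..n} (\<lambda>i. X (t i))"
    by (auto simp: monotone_on_def)
  then have "s permutes {1..n} \<and> antimono_on {1..n} (\<lambda>i. X (s i))"
    unfolding s_def by (rule someI[of "\<lambda>s. s permutes {1..n} \<and> antimono_on {1..n} (\<lambda>i. X (s i))" t])
  then have s: "s i = n + 1 - i" if "i \<in> {1..n}" for i
    using sorting_perm_increasing[of n X s i] inc that by blast
  have im: "s ` {1..i} = {n+1-i..n}" if "i \<le> n" for i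
  proof -
    have "s ` {1..i} = (\<lambda>i. n + 1 - i) ` {1..i}" using that s by (intro image_cong) auto
    also have "\<dots> = {n+1-i..n}"
    proof
      show "{n+1-i..n} \<subseteq> (\<lambda>i. n + 1 - i) ` {1..i}"
      proof
        fix k assume "k \<in> {n+1-i..n}"
        then have "k = n + 1 - (n + 1 - k)" "n + 1 - k \<in> {1..i}" using that by auto
        then show "k \<in> (\<lambda>i. n + 1 - i) ` {1..i}" by (rule image_eqI)
      qed
    qed (use that in auto)
    finally show ?thesis .
  qed
  have "choquet n \<phi> X
      = (\<Sum>i=1..n. (X (s i) - (if i = n then 0 else X (s (i + 1)))) * \<phi> (s ` {1..i}))"
    unfolding choquet_def Let_def s_def by (rule refl)
  also have "{1..n} = insert n {1..<n}" using n by auto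
  finally have "choquet n \<phi> X
      = (\<Sum>i=1..<n. (X (n + 1 - i) - X (n - i)) * \<phi> {n+1-i..n}) + X 1 * \<phi> {1..n}"
    using n s im by (auto intro!: sum.cong)
  \<comment> \<open>The sorted order runs backwards; substituting n - i for i restores increasing
    indices.\<close>
  also have "(\<Sum>i=1..<n. (X (n + 1 - i) - X (n - i)) * \<phi> {n+1-i..n})
      = (\<Sum>i=1..<n. (X (i + 1) - X i) * \<phi> {i+1..n})"
    by (rule sum.reindex_bij_witness[where i = "\<lambda>i. n - i" and j = "\<lambda>i. n - i"])
      (auto simp: Suc_diff_le)
  finally show ?thesis .
qed

text \<open>Abel summation: for an additive set function the Choquet sum over initial segments is
  the ordinary mean of m.\<close>

lemma sum_by_parts_prefix:
  fixes m v :: "nat \<Rightarrow> real"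
  assumes "n > 0"
  shows "(\<Sum>i=1..<n. (m i - m (i + 1)) * (\<Sum>j=1..i. v j)) + m n * (\<Sum>j=1..n. v j)
    = (\<Sum>i=1..n. m i * v i)"
  using assms by (induction n rule: nat_induct_non_zero) (auto simp: algebra_simps)

lemma sum_telescope_prefix:
  fixes m :: "nat \<Rightarrow> real"
  assumes "n > 0"
  shows "(\<Sum>i=1..<n. m i - m (i + 1)) = m 1 - m n"
  using assms by (induction n rule: nat_induct_non_zero) auto

section \<open>Two-monotonicity and additivity of belief functions\<close>

lemma belief_capacity: "\<phi> \<in> belief_functions W \<Longrightarrow> capacity W \<phi>"
  by (simp add: belief_functions_def)

text \<open>Complete monotonicity for k = 2, where the index sets K are {1}, {2} and {1, 2}.\<close>

lemma belief_supermodular: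
  assumes "\<phi> \<in> belief_functions W" "A \<subseteq> W" "B \<subseteq> W"
  shows "\<phi> (A \<union> B) + \<phi> (A \<inter> B) \<ge> \<phi> A + \<phi> B"
proof -
  define F where "F = (\<lambda>i::nat. if i = 1 then A else B)"
  have "\<forall>k\<ge>2. \<forall>A :: nat \<Rightarrow> 'a set. (\<forall>i\<in>{1..k}. A i \<subseteq> W) \<longrightarrow>
        \<phi> (\<Union>i\<in>{1..k}. A i) \<ge>
          (\<Sum>K | K \<noteq> {} \<and> K \<subseteq> {1..k}. (-1) ^ (card K - 1) * \<phi> (\<Inter>i\<in>K. A i))"
    using assms(1) by (simp add: belief_functions_def)
  from this[rule_format, of 2 F] assms(2,3)
  have "\<phi> (\<Union>i\<in>{1..2}. F i)
      \<ge> (\<Sum>K | K \<noteq> {} \<and> K \<subseteq> {1..2}. (-1) ^ (card K - 1) * \<phi> (\<Inter>i\<in>K. F i))"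
    by (auto simp: F_def)
  moreover have "{1..2::nat} = {1, 2}" by auto
  moreover have "{K. K \<noteq> {} \<and> K \<subseteq> {1, 2::nat}} = {{1}, {2}, {1, 2}}" by auto
  ultimately show ?thesis by (simp add: F_def Int_commute)
qed

text \<open>Superadditivity gives one inequality. For the other, 2-monotonicity is applied to A and
  L, then to the union of A and L together with W - L. In the sum the term for the union cancels,
  and the masses of L and W - L add up to 1.\<close>

lemma belief_split:
  assumes bel: "\<phi> \<in> belief_functions W" and "L \<subseteq> W" "\<phi> L + \<phi> (W - L) = 1" "A \<subseteq> W"
  shows "\<phi> A = \<phi> (A \<inter> L) + \<phi> (A - L)"
proof -
  have c: "\<phi> {} = 0" "\<phi> W = 1" using belief_capacity[OF bel] by (auto simp: capacity_def)
  have 1: "\<phi> A \<ge> \<phi> (A \<inter> L) + \<phi> (A - L)"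
  proof -
    have "\<phi> (A \<inter> L \<union> (A - L)) + \<phi> (A \<inter> L \<inter> (A - L)) \<ge> \<phi> (A \<inter> L) + \<phi> (A - L)"
      using assms(4) by (intro belief_supermodular[OF bel]) auto
    moreover have "A \<inter> L \<union> (A - L) = A" "A \<inter> L \<inter> (A - L) = {}" by auto
    ultimately show ?thesis using c by simp
  qed
  have 2: "\<phi> A + \<phi> L \<le> \<phi> (A \<union> L) + \<phi> (A \<inter> L)"
    using assms by (intro belief_supermodular[OF bel]) auto
  have "\<phi> (A \<union> L) + \<phi> (W - L) \<le> \<phi> ((A \<union> L) \<union> (W - L)) + \<phi> ((A \<union> L) \<inter> (W - L))"
    using assms by (intro belief_supermodular[OF bel]) auto
  moreover have "(A \<union> L) \<union> (W - L) = W" "(A \<union> L) \<inter> (W - L) = A - L" using assms by auto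
  ultimately show ?thesis using 1 2 c assms(3) by simp
qed

lemma belief_additive:
  fixes n :: nat
  assumes bel: "\<phi> \<in> belief_functions {1..n}"
    and split: "\<And>i. 1 \<le> i \<Longrightarrow> i < n \<Longrightarrow> \<phi> {1..i} + \<phi> {i+1..n} = 1"
    and "A \<subseteq> {1..n}"
  shows "\<phi> A = (\<Sum>i\<in>A. \<phi> {i})"
proof -
  have c: "\<phi> {} = 0" "\<phi> {1..n} = 1" using belief_capacity[OF bel] by (auto simp: capacity_def)
  \<comment> \<open>The extreme cuts come from the normalization of \<phi>. The cut i = 0 starts the
    induction below, which peels off one point at a time.\<close>
  have split': "\<phi> {1..i} + \<phi> ({1..n} - {1..i}) = 1" if "i \<le> n" for i
  proof -
    have "{1..n} - {1..i} = {i+1..n}" by auto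
    then show ?thesis using split[of i] c that by (cases "i = 0 \<or> i = n") auto
  qed
  have "\<phi> (A \<inter> {1..k}) = (\<Sum>i\<in>A \<inter> {1..k}. \<phi> {i})" if "k \<le> n" for k
    using that
  proof (induction k)
    case 0
    then show ?case using c by simp
  next
    case (Suc k)
    let ?B = "A \<inter> {1..Suc k}"
    have "\<phi> ?B = \<phi> (?B \<inter> {1..k}) + \<phi> (?B - {1..k})"
      using Suc.prems assms(3) by (intro belief_split[OF bel] split') auto
    moreover have B1: "?B \<inter> {1..k} = A \<inter> {1..k}" by auto
    moreover have B2: "?B - {1..k} = A \<inter> {Suc k}" by auto
    moreover have "\<phi> (A \<inter> {Suc k}) = (\<Sum>i\<in>A \<inter> {Suc k}. \<phi> {i})"
      using c by (cases "Suc k \<in> A") auto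
    moreover have "(\<Sum>i\<in>?B. \<phi> {i}) = (\<Sum>i\<in>A \<inter> {1..k}. \<phi> {i}) + (\<Sum>i\<in>A \<inter> {Suc k}. \<phi> {i})"
      using sum.Int_Diff[of ?B "\<lambda>i. \<phi> {i}" "{1..k}"] unfolding B1 B2 by simp
    ultimately show ?case using Suc by simp
  qed
  from this[of n] assms(3) show ?thesis by (simp add: Int_absorb2)
qed

text \<open>For an additive set function inclusion-exclusion gives equality in the monotonicity
  condition.\<close>

lemma additive_belief:
  assumes "\<And>i. i \<in> {1..n} \<Longrightarrow> 0 \<le> v i" "(\<Sum>i=1..n. v i) = 1"
  shows "set_function_of n v \<in> belief_functions {1..n}"
proof -
  let ?F = "set_function_of n v"
  have fin: "finite A" if "A \<subseteq> {1..n}" for A using that by (rule finite_subset) simp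
  have mono: "(\<Sum>i\<in>A. v i) \<le> (\<Sum>i\<in>B. v i)" if "A \<subseteq> B" "B \<subseteq> {1..n}" for A B
    using that assms fin by (intro sum_mono2) auto
  have "capacity {1..n} ?F"
    unfolding capacity_def set_function_of_def
    using assms mono[of _ "{1..n}"] mono by (auto simp: subset_iff intro!: sum_nonneg)
  moreover have "(\<Sum>K | K \<noteq> {} \<and> K \<subseteq> {1..k}. (-1) ^ (card K - 1) * ?F (\<Inter>i\<in>K. A i))
      \<le> ?F (\<Union>i\<in>{1..k}. A i)" if A: "\<forall>i\<in>{1..k}. A i \<subseteq> {1..n}" for k :: nat and A
  proof -
    \<comment> \<open>\<open>set_function_of\<close> is undefined outside \<open>Pow {1..n}\<close>,
      whereas \<open>Incl_Excl_UN\<close> asks for additivity on all disjoint sets; g is the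
      additive extension.\<close>
    define g where "g = (\<lambda>S. \<Sum>i\<in>S \<inter> {1..n}. v i)"
    have Fg: "?F S = g S" if "S \<subseteq> {1..n}" for S
      using that by (simp add: set_function_of_def g_def Int_absorb2)
    have "g (\<Union>i\<in>{1..k}. A i)
        = (\<Sum>K | K \<subseteq> {1..k} \<and> K \<noteq> {}. (-1) ^ (card K + 1) * g (\<Inter>i\<in>K. A i))"
    proof (rule Incl_Excl_UN)
      show "g (S \<union> T) = g S + g T" if "disjnt S T" for S T
        using that unfolding g_def Int_Un_distrib2
        by (intro sum.union_disjoint) (auto simp: disjnt_def)
    qed simp
    also have "\<dots> = (\<Sum>K | K \<noteq> {} \<and> K \<subseteq> {1..k}. (-1) ^ (card K - 1) * ?F (\<Inter>i\<in>K. A i))"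
    proof (rule sum.cong)
      fix K assume "K \<in> {K. K \<noteq> {} \<and> K \<subseteq> {1..k}}"
      then have K: "K \<noteq> {}" "K \<subseteq> {1..k}" "finite K" by (auto intro: finite_subset)
      \<comment> \<open>A nonempty K keeps the intersection inside \<open>{1..n}\<close> and makes
        the truncated exponent \<open>card K - 1\<close> have the parity of
        \<open>card K + 1\<close>.\<close>
      then have "card K > 0" "(\<Inter>i\<in>K. A i) \<subseteq> {1..n}" using A by (auto simp: card_gt_0_iff)
      then show "(-1) ^ (card K + 1) * g (\<Inter>i\<in>K. A i)
          = (-1) ^ (card K - 1) * ?F (\<Inter>i\<in>K. A i)"
        by (cases "card K") (simp_all add: Fg)
    qed auto
    finally show ?thesis using Fg[of "\<Union>i\<in>{1..k}. A i"] A by (simp add: UN_subset_iff)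
  qed
  ultimately show ?thesis by (simp add: belief_functions_def)
qed

section \<open>The feasible set\<close>

lemma set_function_of_apply:
  "A \<subseteq> {1..n} \<Longrightarrow> set_function_of n v A = (\<Sum>i\<in>A. v i)"
  by (simp add: set_function_of_def)

text \<open>Treats the belief and pricing constraints. Domination of the lower probability is
  supplied separately by \<open>lower_prob_le\<close>.\<close>

lemma feasible_iff_mart_vector:
  assumes n: "n > 0"
    and dec: "\<And>i j. 1 \<le> i \<Longrightarrow> i < j \<Longrightarrow> j \<le> n \<Longrightarrow> m j < m i"
    and "1 + r > 0" "S0 > 0"
  shows "\<phi> \<in> belief_functions {1..n} \<and>
      inverse (1 + r) * choquet n \<phi> (price1 m S0) = S0 \<and>
      inverse (1 + r) * choquet n \<phi> (\<lambda>i. - price1 m S0 i) = - S0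
    \<longleftrightarrow> \<phi> \<in> set_function_of n ` mart_vectors n m (1 + r)" (is "?L \<longleftrightarrow> ?R")
proof -
  define dm where "dm = (\<lambda>i. m i - m (i + 1))"
  have dm: "(\<Sum>i=1..<n. dm i) = m 1 - m n"
    unfolding dm_def by (rule sum_telescope_prefix[OF n])
  \<comment> \<open>For normalized \<phi>, \<open>up\<close> and \<open>lo\<close> are the Choquet
    expectations of the final price and of its negative, divided by \<open>S0\<close>; the mass 1 of
    \<open>{1..n}\<close> is already inserted in the last term.\<close>
  define up where "up = (\<lambda>\<phi>. (\<Sum>i=1..<n. dm i * \<phi> {1..i}) + m n)"
  define lo where "lo = (\<lambda>\<phi>. (\<Sum>i=1..<n. dm i * \<phi> {i+1..n}) - m 1)"
  have choq: "inverse (1 + r) * choquet n \<phi> (price1 m S0) = S0 \<longleftrightarrow> up \<phi> = 1 + r"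
    "inverse (1 + r) * choquet n \<phi> (\<lambda>i. - price1 m S0 i) = - S0 \<longleftrightarrow> lo \<phi> = - (1 + r)"
    if bel: "\<phi> \<in> belief_functions {1..n}" for \<phi>
  proof -
    have one: "\<phi> {1..n} = 1" using belief_capacity[OF bel] by (simp add: capacity_def)
    have "choquet n \<phi> (price1 m S0)
        = (\<Sum>i=1..<n. (price1 m S0 i - price1 m S0 (i + 1)) * \<phi> {1..i}) + price1 m S0 n"
      using choquet_decreasing[of n "price1 m S0" \<phi>] dec n one \<open>S0 > 0\<close>
      by (simp add: price1_def)
    also have "\<dots> = S0 * up \<phi>"
      by (simp add: up_def dm_def price1_def sum_distrib_left distrib_left algebra_simps)
    finally have u: "choquet n \<phi> (price1 m S0) = S0 * up \<phi>" .
    have "choquet n \<phi> (\<lambda>i. - price1 m S0 i)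
        = (\<Sum>i=1..<n. (- price1 m S0 (i + 1) - (- price1 m S0 i)) * \<phi> {i+1..n}) - price1 m S0 1"
      using choquet_increasing[of n "\<lambda>i. - price1 m S0 i" \<phi>] dec n one \<open>S0 > 0\<close>
      by (simp add: price1_def)
    also have "\<dots> = S0 * lo \<phi>"
      by (simp add: lo_def dm_def price1_def sum_distrib_left right_diff_distrib algebra_simps)
    finally have l: "choquet n \<phi> (\<lambda>i. - price1 m S0 i) = S0 * lo \<phi>" .
    note scale = discounted_eq_iff[OF \<open>1 + r > 0\<close> \<open>S0 > 0\<close>]
    show "inverse (1 + r) * choquet n \<phi> (price1 m S0) = S0 \<longleftrightarrow> up \<phi> = 1 + r"
      using scale[of "up \<phi>" 1] by (simp add: u)
    show "inverse (1 + r) * choquet n \<phi> (\<lambda>i. - price1 m S0 i) = - S0 \<longleftrightarrow> lo \<phi> = - (1 + r)"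
      using scale[of "lo \<phi>" "-1"] by (simp add: l)
  qed
  have up_additive: "up \<phi> = (\<Sum>i=1..n. m i * \<phi> {i})"
    if "\<And>A. A \<subseteq> {1..n} \<Longrightarrow> \<phi> A = (\<Sum>i\<in>A. \<phi> {i})" "(\<Sum>i=1..n. \<phi> {i}) = 1" for \<phi>
  proof -
    have "(\<Sum>i=1..<n. dm i * \<phi> {1..i}) = (\<Sum>i=1..<n. dm i * (\<Sum>j=1..i. \<phi> {j}))"
    proof (rule sum.cong)
      fix i assume "i \<in> {1..<n}"
      then show "dm i * \<phi> {1..i} = dm i * (\<Sum>j=1..i. \<phi> {j})"
        using that(1)[of "{1..i}"] by auto
    qed simp
    then show ?thesis
      using sum_by_parts_prefix[OF n, of m "\<lambda>i. \<phi> {i}"] that(2) by (simp add: up_def dm_def)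
  qed
  \<comment> \<open>The constants leave m n - m 1, which by telescoping is minus the sum of all
    \<open>dm i\<close> and so puts a -1 into each summand.\<close>
  have gap: "up \<phi> + lo \<phi> = (\<Sum>i=1..<n. dm i * (\<phi> {1..i} + \<phi> {i+1..n} - 1))" for \<phi>
  proof -
    have "(\<Sum>i=1..<n. dm i * (\<phi> {1..i} + \<phi> {i+1..n} - 1))
        = (\<Sum>i=1..<n. dm i * \<phi> {1..i}) + (\<Sum>i=1..<n. dm i * \<phi> {i+1..n}) - (\<Sum>i=1..<n. dm i)"
      by (simp add: sum.distrib sum_subtractf distrib_left right_diff_distrib)
    then show ?thesis using dm by (simp add: up_def lo_def)
  qed
  show ?thesis
  proof
    assume L: ?L
    then have bel: "\<phi> \<in> belief_functions {1..n}" by blast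
    have cap: "capacity {1..n} \<phi>" using bel by (rule belief_capacity)
    have u: "up \<phi> = 1 + r" and l: "lo \<phi> = - (1 + r)" using L choq[OF bel] by auto
    have le: "\<phi> {1..i} + \<phi> {i+1..n} \<le> 1" if "i \<in> {1..<n}" for i
    proof -
      have "{1..i} \<union> {i+1..n} = {1..n}" "{1..i} \<inter> {i+1..n} = {}" using that by auto
      moreover have "\<phi> {1..i} + \<phi> {i+1..n} \<le> \<phi> ({1..i} \<union> {i+1..n}) + \<phi> ({1..i} \<inter> {i+1..n})"
        using that by (intro belief_supermodular[OF bel]) auto
      ultimately show ?thesis using cap by (simp add: capacity_def)
    qed
    have dmpos: "dm i > 0" if "i \<in> {1..<n}" for i
      using that dec[of i "i + 1"] by (auto simp: dm_def)
    \<comment> \<open>The sign is reversed so that all summands are nonnegative; as their sum is 0,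
      each one vanishes, and \<open>dm i > 0\<close> can be divided out.\<close>
    have "(\<Sum>i=1..<n. dm i * (1 - (\<phi> {1..i} + \<phi> {i+1..n}))) = - (up \<phi> + lo \<phi>)"
      unfolding gap sum_negf[symmetric] by (intro sum.cong) (auto simp: algebra_simps)
    then have "(\<Sum>i=1..<n. dm i * (1 - (\<phi> {1..i} + \<phi> {i+1..n}))) = 0"
      using u l by simp
    moreover have "0 \<le> dm i * (1 - (\<phi> {1..i} + \<phi> {i+1..n}))" if "i \<in> {1..<n}" for i
      using dmpos[OF that] le[OF that] by (intro mult_nonneg_nonneg) auto
    ultimately have "\<forall>i\<in>{1..<n}. dm i * (1 - (\<phi> {1..i} + \<phi> {i+1..n})) = 0"
      by (subst (asm) sum_nonneg_eq_0_iff) auto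
    then have split: "\<phi> {1..i} + \<phi> {i+1..n} = 1" if "1 \<le> i" "i < n" for i
      using dmpos[of i] that by force
    have add: "\<phi> A = (\<Sum>i\<in>A. \<phi> {i})" if "A \<subseteq> {1..n}" for A
      using bel split that by (rule belief_additive)
    have one: "(\<Sum>i=1..n. \<phi> {i}) = 1" using add[of "{1..n}"] cap by (simp add: capacity_def)
    have up_eq: "up \<phi> = (\<Sum>i=1..n. m i * \<phi> {i})" using add one by (rule up_additive)
    let ?v = "\<lambda>i\<in>{1..n}. \<phi> {i}"
    have "?v \<in> mart_vectors n m (1 + r)"
      using one up_eq u cap
      by (auto simp: mart_vectors_def capacity_def PiE_iff)
    \<comment> \<open>Outside \<open>Pow {1..n}\<close> both functions are \<open>undefined\<close>,
      since a capacity is extensional there.\<close>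
    moreover have "set_function_of n ?v = \<phi>"
    proof
      fix A
      show "set_function_of n ?v A = \<phi> A"
      proof (cases "A \<subseteq> {1..n}")
        case True
        then have "(\<Sum>i\<in>A. ?v i) = (\<Sum>i\<in>A. \<phi> {i})" by (intro sum.cong) auto
        then show ?thesis using True add by (simp add: set_function_of_apply)
      next
        case False
        then show ?thesis using cap by (auto simp: set_function_of_def capacity_def PiE_iff extensional_def)
      qed
    qed
    ultimately show ?R by (metis image_eqI)
  next
    assume ?R
    then obtain v where v: "v \<in> mart_vectors n m (1 + r)" and \<phi>: "\<phi> = set_function_of n v" by blast
    have sub: "\<phi> A = (\<Sum>i\<in>A. v i)" if "A \<subseteq> {1..n}" for A
      using that by (simp add: \<phi> set_function_of_apply)
    have sing: "\<phi> {i} = v i" if "i \<in> {1..n}" for i using sub[of "{i}"] that by simp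
    have add: "\<phi> A = (\<Sum>i\<in>A. \<phi> {i})" if "A \<subseteq> {1..n}" for A
      unfolding sub[OF that] using that sing by (intro sum.cong) auto
    have s1: "(\<Sum>i=1..n. v i) = 1" and sm: "(\<Sum>i=1..n. m i * v i) = 1 + r"
      using v by (auto simp: mart_vectors_def)
    have bel: "\<phi> \<in> belief_functions {1..n}"
      unfolding \<phi> using v by (intro additive_belief) (auto simp: mart_vectors_def)
    have one: "(\<Sum>i=1..n. \<phi> {i}) = 1" using add[of "{1..n}"] sub[of "{1..n}"] s1 by simp
    have "(\<Sum>i=1..n. m i * \<phi> {i}) = (\<Sum>i=1..n. m i * v i)"
      using sing by (intro sum.cong) auto
    moreover have "up \<phi> = (\<Sum>i=1..n. m i * \<phi> {i})" using add one by (rule up_additive)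
    ultimately have u: "up \<phi> = 1 + r" using sm by simp
    have "\<phi> {1..i} + \<phi> {i+1..n} = 1" if "i \<in> {1..<n}" for i
    proof -
      have "{1..n} = {1..i} \<union> {i+1..n}" using that by auto
      then have "1 = (\<Sum>j\<in>{1..i} \<union> {i+1..n}. v j)" using s1 by simp
      also have "\<dots> = (\<Sum>j=1..i. v j) + (\<Sum>j=i+1..n. v j)"
        by (intro sum.union_disjoint) auto
      finally show ?thesis using that sub[of "{1..i}"] sub[of "{i+1..n}"] by auto
    qed
    \<comment> \<open>Complementary segments have total mass 1, so every term of \<open>gap\<close>
      is 0 and \<open>lo\<close> is determined by \<open>up\<close>.\<close>
    then have "up \<phi> + lo \<phi> = 0" unfolding gap by (intro sum.neutral) auto
    then show ?L using bel choq[OF bel] u by simp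
  qed
qed

section \<open>Attained minima and the two distances\<close>

lemma mart_vectors_attains_min:
  assumes "mart_vectors n m c \<noteq> {}" "continuous_map (powertop_real {1..n}) euclideanreal g"
  shows "\<exists>v\<in>mart_vectors n m c. \<forall>w\<in>mart_vectors n m c. g v \<le> g w"
proof -
  have "compactin euclideanreal (g ` mart_vectors n m c)"
    using compactin_mart_vectors assms(2) by (rule image_compactin)
  then have "compact (g ` mart_vectors n m c)" by simp
  then show ?thesis using compact_attains_inf[of "g ` mart_vectors n m c"] assms(1) by auto
qed

lemma continuous_map_set_function_of:
  assumes "A \<subseteq> {1..n}"
  shows "continuous_map (powertop_real {1..n}) euclideanreal (\<lambda>v. set_function_of n v A)"
  unfolding set_function_of_apply[OF assms]
  using assms finite_subset[OF assms]
  by (auto intro!: continuous_map_sum continuous_map_product_projection)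

text \<open>\<open>LEAST\<close> is a lower bound here because the minimum is attained: evaluation
  at A is continuous on a nonempty compact set.\<close>

lemma lower_prob_le:
  assumes "cl_emm n P m r S0 = set_function_of n ` mart_vectors n m c"
    and "\<phi> \<in> cl_emm n P m r S0" "A \<subseteq> {1..n}"
  shows "lower_prob n P m r S0 A \<le> \<phi> A"
proof -
  have "mart_vectors n m c \<noteq> {}" using assms by auto
  then obtain v where v: "v \<in> mart_vectors n m c"
    "\<forall>w\<in>mart_vectors n m c. set_function_of n v A \<le> set_function_of n w A"
    using mart_vectors_attains_min continuous_map_set_function_of[OF assms(3)] by blast
  have "(LEAST x. x \<in> (\<lambda>Q. Q A) ` cl_emm n P m r S0) = set_function_of n v A"
    using v assms(1) by (intro Least_equality) auto
  then show ?thesis using v assms by (auto simp: lower_prob_def)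
qed

text \<open>Pair each event with its complement: the two masses add up to 1, and complementation
  permutes the power set.\<close>

lemma sum_Pow_additive:
  fixes v :: "nat \<Rightarrow> real"
  assumes "(\<Sum>i\<in>W. v i) = 1" "finite W"
  shows "2 * (\<Sum>A\<in>Pow W. \<Sum>i\<in>A. v i) = 2 ^ card W"
proof -
  have "(\<Sum>A\<in>Pow W. \<Sum>i\<in>A. v i) = (\<Sum>A\<in>Pow W. \<Sum>i\<in>W - A. v i)"
    by (rule sum.reindex_bij_witness[where i = "\<lambda>A. W - A" and j = "\<lambda>A. W - A"])
      (auto simp: double_diff)
  moreover have "(\<Sum>A\<in>Pow W. (\<Sum>i\<in>A. v i) + (\<Sum>i\<in>W - A. v i)) = (\<Sum>A\<in>Pow W. 1)"
  proof (rule sum.cong)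
    fix A assume "A \<in> Pow W"
    then show "(\<Sum>i\<in>A. v i) + (\<Sum>i\<in>W - A. v i) = 1"
      using sum.subset_diff[of A W v] assms by (simp add: add.commute)
  qed simp
  ultimately show ?thesis using assms by (simp add: sum.distrib card_Pow)
qed

text \<open>Domination removes the absolute values, and the total mass over all events is the same
  for every v, so the distance does not depend on v.\<close>

lemma dist1_set_function_of:
  assumes "v \<in> mart_vectors n m c"
    and "\<And>A. A \<subseteq> {1..n} \<Longrightarrow> q A \<le> set_function_of n v A"
  shows "dist1 {1..n} (set_function_of n v) q = 2 ^ n / 2 - (\<Sum>A\<in>Pow {1..n}. q A)"
proof -
  have "dist1 {1..n} (set_function_of n v) q = (\<Sum>A\<in>Pow {1..n}. (\<Sum>i\<in>A. v i) - q A)"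
    unfolding dist1_def using assms(2)
    by (intro sum.cong) (auto simp: set_function_of_apply abs_of_nonneg)
  then show ?thesis
    using sum_Pow_additive[of v "{1..n}"] assms(1)
    by (simp add: sum_subtractf mart_vectors_def)
qed

lemma set_function_of_convex:
  assumes "A \<subseteq> {1..n}"
  shows "set_function_of n (\<lambda>i\<in>{1..n}. (1 - t) * v i + t * w i) A
    = (1 - t) * set_function_of n v A + t * set_function_of n w A"
proof -
  have "(\<Sum>i\<in>A. (\<lambda>i\<in>{1..n}. (1 - t) * v i + t * w i) i) = (\<Sum>i\<in>A. (1 - t) * v i + t * w i)"
    using assms by (intro sum.cong) auto
  then show ?thesis
    using assms by (simp add: set_function_of_apply sum.distrib sum_distrib_left)
qed

lemma dist2_unique_min:
  assumes "mart_vectors n m c \<noteq> {}"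
  defines "C \<equiv> set_function_of n ` mart_vectors n m c"
  shows "\<exists>!f. f \<in> C \<and> (\<forall>g\<in>C. dist2 {1..n} f q \<le> dist2 {1..n} g q)"
proof -
  let ?d = "\<lambda>f. dist2 {1..n} f q"
  have "continuous_map (powertop_real {1..n}) euclideanreal (\<lambda>v. ?d (set_function_of n v))"
    unfolding dist2_def
    by (intro continuous_map_sum continuous_map_real_pow continuous_map_diff
        continuous_map_set_function_of) auto
  then have ex: "\<exists>f. f \<in> C \<and> (\<forall>g\<in>C. ?d f \<le> ?d g)"
    using mart_vectors_attains_min[OF assms(1)] by (auto simp: C_def)
  moreover have "f = g"
    if f: "f \<in> C" "\<forall>h\<in>C. ?d f \<le> ?d h" and g: "g \<in> C" "\<forall>h\<in>C. ?d g \<le> ?d h" for f g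
  proof -
    obtain v w where v: "v \<in> mart_vectors n m c" "f = set_function_of n v"
      and w: "w \<in> mart_vectors n m c" "g = set_function_of n w"
      using f(1) g(1) by (auto simp: C_def)
    \<comment> \<open>The midpoint of two minimizers, again in C by convexity.\<close>
    define h where "h = set_function_of n (\<lambda>i\<in>{1..n}. (1 - 1/2) * v i + 1/2 * w i)"
    have "h \<in> C"
      unfolding h_def C_def using mart_vectors_convex[OF v(1) w(1), of "1/2"] by auto
    have h: "h A = (f A + g A) / 2" if "A \<subseteq> {1..n}" for A
      unfolding h_def set_function_of_convex[OF that] by (simp add: v w)
    \<comment> \<open>The parallelogram identity for f - q and g - q, whose sum is 2 * (h - q).
      Since neither f nor g is farther from q than h, the squared differences of f and g must sum to
      0.\<close>
    have "4 * ?d h + (\<Sum>A\<in>Pow {1..n}. (f A - g A)\<^sup>2) = 2 * ?d f + 2 * ?d g"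
      unfolding dist2_def sum_distrib_left sum.distrib[symmetric]
      by (rule sum.cong) (auto simp: h power2_eq_square field_simps)
    moreover have "?d f \<le> ?d h" "?d g \<le> ?d h" using f g \<open>h \<in> C\<close> by auto
    ultimately have "(\<Sum>A\<in>Pow {1..n}. (f A - g A)\<^sup>2) \<le> 0" by linarith
    then have "(\<Sum>A\<in>Pow {1..n}. (f A - g A)\<^sup>2) = 0" by (intro antisym sum_nonneg) auto
    then have eq: "f A = g A" if "A \<subseteq> {1..n}" for A
      using that by (subst (asm) sum_nonneg_eq_0_iff) auto
    show "f = g"
    proof
      fix A show "f A = g A"
        using eq by (cases "A \<subseteq> {1..n}") (simp_all add: v w set_function_of_def)
    qed
  qed
  ultimately show ?thesis by blast
qed

text \<open>\<open>is_arg_min\<close> only excludes strictly smaller values; linearity of the order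
  on the reals gives the comparison with every feasible point.\<close>

lemma optimal_solutions_iff:
  fixes p :: "'a minimization_problem"
  shows "x \<in> optimal_solutions p \<longleftrightarrow> x \<in> feasible_solutions p \<and>
    (\<forall>y\<in>feasible_solutions p. objective p x \<le> objective p y)"
  by (auto simp: optimal_solutions_def is_arg_min_linorder)

theorem theorem6:
  fixes n :: nat and m :: "nat \<Rightarrow> real" and r S0 :: real and P :: "nat measure"
  assumes "n > 2"
    and "\<And>i j. 1 \<le> i \<Longrightarrow> i < j \<Longrightarrow> j \<le> n \<Longrightarrow> m i > m j"
    and "m n > 0"
    and "1 + r > 0"
    and "m 1 > 1 + r"
    and "1 + r > m n"
    and "S0 > 0"
    and "prob_space P"
    and "sets P = Pow {1..n}"
    and "\<And>i. i \<in> {1..n} \<Longrightarrow> measure P {i} > 0"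
  shows "(\<forall>d. feasible_solutions (belief_problem n P m r S0 d) = cl_emm n P m r S0) \<and>
    optimal_solutions (belief_problem n P m r S0 (dist1 {1..n})) = cl_emm n P m r S0 \<and>
    (\<exists>!Bel. Bel \<in> optimal_solutions (belief_problem n P m r S0 (dist2 {1..n})))"
proof -
  let ?q = "lower_prob n P m r S0"
  have n: "n > 0" using assms(1) by simp
  have cl: "cl_emm n P m r S0 = set_function_of n ` mart_vectors n m (1 + r)"
    using n assms by (intro cl_emm_eq) auto
  \<comment> \<open>Here 1 + r must lie strictly between the smallest factor \<open>m n\<close> and
    the largest factor \<open>m 1\<close>.\<close>
  have ne: "mart_vectors n m (1 + r) \<noteq> {}"
    using pos_mart_vectors_nonempty[of n n 1 m "1 + r"] n assms by (auto simp: pos_mart_vectors_def)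
  have mart: "\<phi> \<in> belief_functions {1..n} \<and>
      inverse (1 + r) * choquet n \<phi> (price1 m S0) = S0 \<and>
      inverse (1 + r) * choquet n \<phi> (\<lambda>i. - price1 m S0 i) = - S0
    \<longleftrightarrow> \<phi> \<in> cl_emm n P m r S0" for \<phi>
    unfolding cl using n assms(2,4,7) by (rule feasible_iff_mart_vector)
  have feas: "feasible_solutions (belief_problem n P m r S0 d) = cl_emm n P m r S0" for d
    using mart lower_prob_le[OF cl]
    by (auto simp: belief_problem_def)
  have obj: "objective (belief_problem n P m r S0 d) f = d f ?q" for d f
    by (simp add: belief_problem_def)
  have "dist1 {1..n} f ?q = 2 ^ n / 2 - (\<Sum>A\<in>Pow {1..n}. ?q A)"
    if f: "f \<in> cl_emm n P m r S0" for f
  proof -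
    obtain v where "v \<in> mart_vectors n m (1 + r)" "f = set_function_of n v"
      using f unfolding cl by blast
    then show ?thesis using dist1_set_function_of lower_prob_le[OF cl f] by metis
  qed
  \<comment> \<open>The objective takes the same value at all feasible points, so each of them is
    optimal.\<close>
  then have "optimal_solutions (belief_problem n P m r S0 (dist1 {1..n})) = cl_emm n P m r S0"
    by (auto simp: optimal_solutions_iff feas obj)
  moreover have "\<exists>!Bel. Bel \<in> optimal_solutions (belief_problem n P m r S0 (dist2 {1..n}))"
    unfolding optimal_solutions_iff feas obj cl by (rule dist2_unique_min[OF ne])
  ultimately show ?thesis using feas by blast
qed

end
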